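(* Let $p\in\Pi$ and let $\mathcal{Q}_{\Diamond^{\geq2}p}$ be the node query consisting of all pointed graphs $G^u$ in which $u$ has at least two neighbors labeled $p$. There does not exist a key-invariant LocalMax GNN whose combination functions are feedforward networks with unary semilinear activation functions that expresses $\mathcal{Q}_{\Diamond^{\geq2}p}$.
   Context: Fix a finite set $\Pi=\{p_1,\dots,p_n\}$ of propositions. A graph is $G=(V,E,\mathrm{lab})$ with $V$ finite, $E\subseteq V\times V$ irreflexive and symmetric, $\mathrm{lab}:V\to\{0,1\}^n$ (node $v$ is labeled $p_i$ iff $\mathrm{lab}(v)_i=1$); a pointed graph $G^u$ has distinguished node $u$; a node query is an isomorphism-closed class of pointed graphs. A keyed extension adds an injective $\mathrm{key}:V\to\mathbb{R}$. A GNN is a sequence of layers $(\mathrm{agg}_i,\mathrm{com}_i)_{i=1}^\ell$, $\mathrm{com}_i:\mathbb{R}^{2D_i}\to\mathbb{R}^{D_{i+1}}$, $D_1=n+1$, $D_{\ell+1}=1$; on a keyed graph the initial embedding is $\mathrm{lab}(v)\oplus(\mathrm{key}(v))$, each layer computes $\mathrm{emb}'(u)=\mathrm{com}_i(\mathrm{emb}(u),\mathrm{agg}_i(\{\!\{\mathrm{emb}(v)\mid(u,v)\in E\}\!\}))$, output is the final value at the distinguished node. LocalMax: each $\mathrm{agg}_i$ is coordinate-wise max (empty max $=0$). Accept iff output $>0$; key-invariant if for every pointed graph all or none of its keyed extensions are accepted; then it expresses the query of pointed graphs whose keyed extensions are accepted. A unary semilinear function is an $f:\mathbb{R}\to\mathbb{R}$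 definable by a first-order formula without parameters over $(\mathbb{R},+,<,0,1)$. A feedforward network with activations from a set $A$ of unary functions is a composition of affine maps with rational coefficients and coordinate-wise applications of functions from $A$. *)

theory Defs
  imports
    Complex_Main
    "HOL-Library.Multiset"
    "HOL-Library.Infinite_Typeclass"
    "Jordan_Normal_Form.Matrix"
begin

section \<open>Labeled graphs and node queries\<close>

text \<open>The propositions are \<open>p\<^sub>1, \<dots>, p\<^sub>n\<close>, indexed here by \<open>0, \<dots>, n - 1\<close>.
  Only the labels (and, below, the keys) of the nodes of a graph are relevant.\<close>

record 'v graph =
  nodes :: "'v set"
  edges :: "('v \<times> 'v) set"
  lab :: "'v \<Rightarrow> real vec"

definition is_graph :: "nat \<Rightarrow> 'v graph \<Rightarrow> bool" where
  "is_graph n G \<longleftrightarrow>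
     finite (nodes G) \<and> edges G \<subseteq> nodes G \<times> nodes G \<and> irrefl (edges G) \<and> sym (edges G) \<and>
     (\<forall>v\<in>nodes G. lab G v \<in> carrier_vec n \<and> (\<forall>i<n. lab G v $ i \<in> {0, 1}))"

type_synonym 'v pointed_graph = "'v graph \<times> 'v"

definition pointed_graphs :: "nat \<Rightarrow> 'v pointed_graph set" where
  "pointed_graphs n = {(G, u). is_graph n G \<and> u \<in> nodes G}"

definition neighbors :: "'v graph \<Rightarrow> 'v \<Rightarrow> 'v set" where
  "neighbors G u = {v. (u, v) \<in> edges G}"

definition pointed_isomorphic :: "'v pointed_graph \<Rightarrow> 'v pointed_graph \<Rightarrow> bool" where
  "pointed_isomorphic P P' \<longleftrightarrow>
     (case (P, P') of ((G, u), (G', u')) \<Rightarrow>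
       (\<exists>h. bij_betw h (nodes G) (nodes G') \<and> h u = u' \<and>
         (\<forall>v\<in>nodes G. \<forall>w\<in>nodes G. (v, w) \<in> edges G \<longleftrightarrow> (h v, h w) \<in> edges G') \<and>
         (\<forall>v\<in>nodes G. lab G' (h v) = lab G v)))"

definition node_query :: "nat \<Rightarrow> 'v pointed_graph set \<Rightarrow> bool" where
  "node_query n Q \<longleftrightarrow>
     Q \<subseteq> pointed_graphs n \<and>
     (\<forall>P\<in>Q. \<forall>P'\<in>pointed_graphs n. pointed_isomorphic P P' \<longrightarrow> P' \<in> Q)"

definition diamond_ge2_query :: "nat \<Rightarrow> nat \<Rightarrow> 'v pointed_graph set" where
  "diamond_ge2_query n p =
     {(G, u) \<in> pointed_graphs n. card {v \<in> neighbors G u. lab G v $ p = 1} \<ge> 2}"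

lemma node_query_diamond_ge2_query: "node_query n (diamond_ge2_query n p)"
proof -
  have "card {v \<in> neighbors G' (h u). lab G' v $ p = 1} =
        card {v \<in> neighbors G u. lab G v $ p = 1}"
    if G: "is_graph n G" and G': "is_graph n G'" and u: "u \<in> nodes G"
      and h: "bij_betw h (nodes G) (nodes G')"
      and E: "\<forall>v\<in>nodes G. \<forall>w\<in>nodes G. (v, w) \<in> edges G \<longleftrightarrow> (h v, h w) \<in> edges G'"
      and L: "\<forall>v\<in>nodes G. lab G' (h v) = lab G v"
    for G G' :: "'a graph" and u h
  proof -
    let ?A = "{v \<in> neighbors G u. lab G v $ p = 1}"
    have sub: "?A \<subseteq> nodes G"
      using G by (auto simp: is_graph_def neighbors_def)
    have "{v \<in> neighbors G' (h u). lab G' v $ p = 1} = h ` ?A"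
    proof (intro equalityI subsetI)
      fix w assume w: "w \<in> {v \<in> neighbors G' (h u). lab G' v $ p = 1}"
      then have "w \<in> nodes G'"
        using G' by (auto simp: is_graph_def neighbors_def)
      then obtain v where "v \<in> nodes G" "w = h v"
        using h by (auto simp: bij_betw_def)
      then show "w \<in> h ` ?A"
        using w u E L by (auto simp: neighbors_def)
    next
      fix w assume "w \<in> h ` ?A"
      then show "w \<in> {v \<in> neighbors G' (h u). lab G' v $ p = 1}"
        using sub u E L by (auto simp: neighbors_def)
    qed
    moreover have "inj_on h ?A"
      using h sub by (meson bij_betw_def inj_on_subset)
    ultimately show ?thesis
      by (simp add: card_image)
  qed
  note card_eq = this
  show ?thesis
    unfolding node_query_def
  proof (intro conjI ballI impI)
    show "diamond_ge2_query n p \<subseteq> pointed_graphs n"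
      by (auto simp: diamond_ge2_query_def)
  next
    fix P P' :: "'a pointed_graph"
    assume P: "P \<in> diamond_ge2_query n p" and P': "P' \<in> pointed_graphs n"
      and iso: "pointed_isomorphic P P'"
    obtain G u G' u' where [simp]: "P = (G, u)" "P' = (G', u')"
      by (cases P, cases P')
    from iso obtain h where h: "bij_betw h (nodes G) (nodes G')" "h u = u'"
      "\<forall>v\<in>nodes G. \<forall>w\<in>nodes G. (v, w) \<in> edges G \<longleftrightarrow> (h v, h w) \<in> edges G'"
      "\<forall>v\<in>nodes G. lab G' (h v) = lab G v"
      unfolding pointed_isomorphic_def by force
    have G: "is_graph n G" "u \<in> nodes G" "is_graph n G'"
      using P P' by (simp_all add: diamond_ge2_query_def pointed_graphs_def)
    from card_eq[OF G(1,3,2) h(1,3,4)] P P' h(2) show "P' \<in> diamond_ge2_query n p"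
      by (simp add: diamond_ge2_query_def)
  qed
qed

section \<open>Graph neural networks on keyed graphs\<close>

record gnn_layer =
  in_dim :: nat
  out_dim :: nat
  agg :: "real vec multiset \<Rightarrow> real vec"
  com :: "real vec \<Rightarrow> real vec"

type_synonym gnn = "gnn_layer list"

definition is_layer :: "gnn_layer \<Rightarrow> bool" where
  "is_layer L \<longleftrightarrow>
     (\<forall>X. set_mset X \<subseteq> carrier_vec (in_dim L) \<longrightarrow> agg L X \<in> carrier_vec (in_dim L)) \<and>
     com L \<in> carrier_vec (2 * in_dim L) \<rightarrow> carrier_vec (out_dim L)"

definition is_gnn :: "nat \<Rightarrow> gnn \<Rightarrow> bool" where
  "is_gnn n N \<longleftrightarrow>
     N \<noteq> [] \<and> in_dim (hd N) = n + 1 \<and> out_dim (last N) = 1 \<and>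
     (\<forall>i. Suc i < length N \<longrightarrow> out_dim (N ! i) = in_dim (N ! Suc i)) \<and>
     (\<forall>L\<in>set N. is_layer L)"

definition is_key :: "'v graph \<Rightarrow> ('v \<Rightarrow> real) \<Rightarrow> bool" where
  "is_key G key \<longleftrightarrow> inj_on key (nodes G)"

definition initial_emb :: "'v graph \<Rightarrow> ('v \<Rightarrow> real) \<Rightarrow> 'v \<Rightarrow> real vec" where
  "initial_emb G key v = lab G v @\<^sub>v vec_of_list [key v]"

definition layer_step :: "'v graph \<Rightarrow> gnn_layer \<Rightarrow> ('v \<Rightarrow> real vec) \<Rightarrow> 'v \<Rightarrow> real vec" where
  "layer_step G L emb u =
     com L (emb u @\<^sub>v agg L (image_mset emb (mset_set (neighbors G u))))"

definition gnn_output :: "gnn \<Rightarrow> 'v pointed_graph \<Rightarrow> ('v \<Rightarrow> real) \<Rightarrow> real" where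
  "gnn_output N P key =
     (case P of (G, u) \<Rightarrow> fold (layer_step G) N (initial_emb G key) u $ 0)"

definition accepts :: "gnn \<Rightarrow> 'v pointed_graph \<Rightarrow> ('v \<Rightarrow> real) \<Rightarrow> bool" where
  "accepts N P key \<longleftrightarrow> gnn_output N P key > 0"

text \<open>Key-invariance ranges over the pointed graphs with nodes in the type \<open>'v\<close>. When \<open>'v\<close>
  is infinite, these are all finite pointed graphs up to isomorphism.\<close>

definition key_invariant :: "'v itself \<Rightarrow> nat \<Rightarrow> gnn \<Rightarrow> bool" where
  "key_invariant _ n N \<longleftrightarrow>
     (\<forall>P \<in> (pointed_graphs n :: 'v pointed_graph set).
        (\<forall>key. is_key (fst P) key \<longrightarrow> accepts N P key) \<or>
        (\<forall>key. is_key (fst P) key \<longrightarrow> \<not> accepts N P key))"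

definition expresses :: "nat \<Rightarrow> gnn \<Rightarrow> 'v pointed_graph set \<Rightarrow> bool" where
  "expresses n N Q \<longleftrightarrow>
     Q = {P \<in> pointed_graphs n. \<forall>key. is_key (fst P) key \<longrightarrow> accepts N P key}"

definition coordinatewise_max :: "nat \<Rightarrow> real vec multiset \<Rightarrow> real vec" where
  "coordinatewise_max d X =
     vec d (\<lambda>i. if X = {#} then 0 else Max ((\<lambda>x. x $ i) ` set_mset X))"

definition local_max_gnn :: "nat \<Rightarrow> gnn \<Rightarrow> bool" where
  "local_max_gnn n N \<longleftrightarrow>
     is_gnn n N \<and>
     (\<forall>L\<in>set N. \<forall>X. set_mset X \<subseteq> carrier_vec (in_dim L) \<longrightarrow>
        agg L X = coordinatewise_max (in_dim L) X)"

section \<open>Unary semilinear functions\<close>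

text \<open>First-order logic over the structure \<open>(\<real>, +, <, 0, 1)\<close>, with named variables.\<close>

datatype trm = TVar nat | TZero | TOne | TAdd trm trm

datatype form = FEq trm trm | FLess trm trm | FNot form | FAnd form form | FEx nat form

primrec trm_vars :: "trm \<Rightarrow> nat set" where
  "trm_vars (TVar x) = {x}"
| "trm_vars TZero = {}"
| "trm_vars TOne = {}"
| "trm_vars (TAdd s t) = trm_vars s \<union> trm_vars t"

primrec free_vars :: "form \<Rightarrow> nat set" where
  "free_vars (FEq s t) = trm_vars s \<union> trm_vars t"
| "free_vars (FLess s t) = trm_vars s \<union> trm_vars t"
| "free_vars (FNot \<phi>) = free_vars \<phi>"
| "free_vars (FAnd \<phi> \<psi>) = free_vars \<phi> \<union> free_vars \<psi>"
| "free_vars (FEx x \<phi>) = free_vars \<phi> - {x}"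

primrec trm_val :: "(nat \<Rightarrow> real) \<Rightarrow> trm \<Rightarrow> real" where
  "trm_val e (TVar x) = e x"
| "trm_val e TZero = 0"
| "trm_val e TOne = 1"
| "trm_val e (TAdd s t) = trm_val e s + trm_val e t"

primrec sat :: "(nat \<Rightarrow> real) \<Rightarrow> form \<Rightarrow> bool" where
  "sat e (FEq s t) \<longleftrightarrow> trm_val e s = trm_val e t"
| "sat e (FLess s t) \<longleftrightarrow> trm_val e s < trm_val e t"
| "sat e (FNot \<phi>) \<longleftrightarrow> \<not> sat e \<phi>"
| "sat e (FAnd \<phi> \<psi>) \<longleftrightarrow> sat e \<phi> \<and> sat e \<psi>"
| "sat e (FEx x \<phi>) \<longleftrightarrow> (\<exists>r. sat (e(x := r)) \<phi>)"

text \<open>The graph of \<open>f\<close> is defined by a formula whose free variables are \<open>0\<close> (argument)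
  and \<open>1\<close> (value).\<close>

definition unary_semilinear :: "(real \<Rightarrow> real) \<Rightarrow> bool" where
  "unary_semilinear f \<longleftrightarrow>
     (\<exists>\<phi>. free_vars \<phi> \<subseteq> {0, 1} \<and> (\<forall>e. sat e \<phi> \<longleftrightarrow> e 1 = f (e 0)))"

section \<open>Feedforward networks\<close>

text \<open>Functions \<open>\<real>\<^sup>k \<rightarrow> \<real>\<^sup>m\<close> are represented by functions on \<^typ>\<open>real vec\<close>, whose values
  outside \<open>carrier_vec k\<close> are irrelevant. A coordinate-wise application may use a
  different activation function in each coordinate.\<close>

definition rational_affine :: "nat \<Rightarrow> nat \<Rightarrow> (real vec \<Rightarrow> real vec) \<Rightarrow> bool" where
  "rational_affine k m f \<longleftrightarrow>
     (\<exists>M b. M \<in> carrier_mat m k \<and> b \<in> carrier_vec m \<and>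
        (\<forall>i<m. \<forall>j<k. M $$ (i, j) \<in> \<rat>) \<and> (\<forall>i<m. b $ i \<in> \<rat>) \<and>
        (\<forall>x\<in>carrier_vec k. f x = M *\<^sub>v x + b))"

definition coordinatewise :: "(real \<Rightarrow> real) set \<Rightarrow> nat \<Rightarrow> (real vec \<Rightarrow> real vec) \<Rightarrow> bool" where
  "coordinatewise A k f \<longleftrightarrow>
     (\<exists>\<sigma>. (\<forall>i<k. \<sigma> i \<in> A) \<and> (\<forall>x\<in>carrier_vec k. f x = vec k (\<lambda>i. \<sigma> i (x $ i))))"

inductive feedforward ::
  "(real \<Rightarrow> real) set \<Rightarrow> nat \<Rightarrow> nat \<Rightarrow> (real vec \<Rightarrow> real vec) \<Rightarrow> bool" for A where
  affine: "rational_affine k m f \<Longrightarrow> feedforward A k m f"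
| activation: "coordinatewise A k f \<Longrightarrow> feedforward A k k f"
| compose: "feedforward A k l f \<Longrightarrow> feedforward A l m g \<Longrightarrow>
    (\<forall>x\<in>carrier_vec k. h x = g (f x)) \<Longrightarrow> feedforward A k m h"

end

theory Submission
  imports Defs "HOL-Computational_Algebra.Polynomial"
begin

text \<open>Quantifier elimination makes every unary semilinear function affine near \<open>\<infinity>\<close> and near
  \<open>-\<infinity>\<close>. Consider a star whose center has key \<open>1\<close> and whose leaf \<open>v\<close> has key \<open>t ^ v\<close>, for a large
  number \<open>t\<close>. All embeddings are then eventually polynomials in \<open>t\<close>, and a coordinate of leaf \<open>v\<close>
  has the form \<open>A t\<^sup>v + B(t) + c\<close> where \<open>A\<close> and \<open>B\<close> are the same for all leaves in an interval and
  only the constant \<open>c\<close> depends on the label: a label changes values by a bounded amount, while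
  the activations see only the sign of the dominant term. The maximum at the center is attained at
  the innermost or the outermost leaf of the interval, or else it depends only on which labels
  occur, so each layer singles out just two further leaves. With more than twice as many leaves
  as layers, the center cannot tell one labeled leaf in the middle from two.\<close>

section \<open>Affine forms and quantifier elimination\<close>

text \<open>The slope \<open>c\<close> may depend on \<open>x\<close> but not on \<open>e\<close>,
  which excludes products of variables.\<close>

definition affine_form :: "((nat \<Rightarrow> real) \<Rightarrow> real) \<Rightarrow> bool" where
  "affine_form L \<longleftrightarrow> (\<forall>x. \<exists>c. \<forall>e r. L (e(x := r)) = L e + c * (r - e x))"

definition slope :: "nat \<Rightarrow> ((nat \<Rightarrow> real) \<Rightarrow> real) \<Rightarrow> real" where
  "slope x L = (SOME c. \<forall>e r. L (e(x := r)) = L e + c * (r - e x))"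

lemma affine_form_upd:
  assumes "affine_form L"
  shows "L (e(x := r)) = L e + slope x L * (r - e x)"
proof -
  have "\<exists>c. \<forall>e r. L (e(x := r)) = L e + c * (r - e x)"
    using assms by (simp add: affine_form_def)
  from someI_ex[OF this] show ?thesis
    unfolding slope_def by blast
qed

lemma affine_formI:
  assumes "\<And>x e r. L (e(x := r)) = L e + c x * (r - e x)"
  shows "affine_form L"
  using assms by (auto simp: affine_form_def)

lemma affine_form_diff:
  assumes "affine_form L" "affine_form M"
  shows "affine_form (\<lambda>e. L e - M e)"
  by (rule affine_formI[where c = "\<lambda>x. slope x L - slope x M"])
     (simp add: affine_form_upd[OF assms(1)] affine_form_upd[OF assms(2)] algebra_simps)

lemma affine_form_trm_val: "affine_form (\<lambda>e. trm_val e s)"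
proof (induction s)
  case (TVar y)
  show ?case
    by (rule affine_formI[where c = "\<lambda>x. if x = y then 1 else 0"]) auto
next
  case (TAdd s t)
  show ?case
    by (rule affine_formI[where c = "\<lambda>x. slope x (\<lambda>e. trm_val e s) + slope x (\<lambda>e. trm_val e t)"])
       (simp only: trm_val.simps affine_form_upd[OF TAdd.IH(1)] affine_form_upd[OF TAdd.IH(2)],
        simp add: algebra_simps)
qed (rule affine_formI[where c = "\<lambda>_. 0"], simp)+

text \<open>The value of the variable \<open>x\<close> at which \<open>L\<close> vanishes; it does not depend on \<open>e x\<close>.\<close>

definition form_root :: "nat \<Rightarrow> ((nat \<Rightarrow> real) \<Rightarrow> real) \<Rightarrow> (nat \<Rightarrow> real) \<Rightarrow> real" where
  "form_root x L e = e x - L e / slope x L"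

lemma affine_form_form_root:
  assumes "affine_form L"
  shows "affine_form (form_root x L)"
  by (rule affine_formI[where c = "\<lambda>y. (if y = x then 1 else 0) - slope y L / slope x L"])
     (auto simp: form_root_def affine_form_upd[OF assms] algebra_simps add_divide_distrib
        diff_divide_distrib)

lemma affine_form_eq_form_root:
  assumes "affine_form L" "slope x L \<noteq> 0"
  shows "L (e(x := r)) = slope x L * (r - form_root x L e)"
  using assms(2) by (simp add: affine_form_upd[OF assms(1)] form_root_def field_simps)

text \<open>The semantic counterpart of a quantifier-free equivalent: for finite \<open>S\<close>,
  the formula is a Boolean combination of sign conditions.\<close>

definition signs_determine :: "((nat \<Rightarrow> real) \<Rightarrow> real) set \<Rightarrow> form \<Rightarrow> bool" where
  "signs_determine S \<phi> \<longleftrightarrow>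
     (\<forall>e e'. (\<forall>L\<in>S. sgn (L e) = sgn (L e')) \<longrightarrow> sat e \<phi> = sat e' \<phi>)"

text \<open>The two families of points are ordered alike, ties included. If \<open>r\<close> hits a
  point, the matching point serves; if \<open>r\<close> lies in a gap, the matching gap contains a
  real number by density and unboundedness.\<close>

lemma exists_same_position:
  fixes u u' :: "'i \<Rightarrow> real"
  assumes "finite I"
    and same: "\<And>i j. i \<in> I \<Longrightarrow> j \<in> I \<Longrightarrow> sgn (u i - u j) = sgn (u' i - u' j)"
  shows "\<exists>r'. \<forall>i\<in>I. sgn (r - u i) = sgn (r' - u' i)"
proof (cases "\<exists>i\<in>I. u i = r")
  case True
  then obtain i where "i \<in> I" "u i = r" by blast
  then have "\<forall>j\<in>I. sgn (r - u j) = sgn (u' i - u' j)"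
    using same by blast
  then show ?thesis by blast
next
  case False
  define A where "A = u' ` {i\<in>I. u i < r}"
  define B where "B = u' ` {i\<in>I. r < u i}"
  have fin: "finite A" "finite B"
    using \<open>finite I\<close> by (auto simp: A_def B_def)
  have lt: "u' i < u' j" if "i \<in> I" "j \<in> I" "u i < u j" for i j
    using same[OF that(1,2)] that(3) by (auto simp: sgn_if split: if_splits)
  have AB: "x < y" if "x \<in> A" "y \<in> B" for x y
    using that lt by (fastforce simp: A_def B_def)
  obtain r' where r': "\<forall>x\<in>A. x < r'" "\<forall>y\<in>B. r' < y"
  proof (cases "A = {} \<or> B = {}")
    case True
    then show thesis
    proof
      assume A: "A = {}"
      \<comment> \<open>Inserting \<open>0\<close> keeps \<open>Min\<close> well defined when
        \<open>B\<close> is empty too.\<close>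
      have "Min (insert 0 B) - 1 < y" if "y \<in> B" for y
      proof -
        have "Min (insert 0 B) \<le> y"
          by (rule Min_le) (use fin that in auto)
        then show ?thesis by linarith
      qed
      then show thesis
        using A that by blast
    next
      assume B: "B = {}"
      have "y < Max (insert 0 A) + 1" if "y \<in> A" for y
      proof -
        have "y \<le> Max (insert 0 A)"
          by (rule Max_ge) (use fin that in auto)
        then show ?thesis by linarith
      qed
      then show thesis
        using B that by blast
    qed
  next
    case False
    then have "Max A < Min B"
      using AB fin by simp
    then obtain r' where "Max A < r'" "r' < Min B"
      using dense by blast
    then show thesis
      using False fin that[of r'] by simp
  qed
  have "sgn (r - u i) = sgn (r' - u' i)" if i: "i \<in> I" for i
  proof -
    consider "u i < r" | "r < u i"
      using False i by fastforce
    then show ?thesis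
    proof cases
      case 1
      then have "u' i < r'" using r'(1) i by (auto simp: A_def)
      then show ?thesis using 1 by simp
    next
      case 2
      then have "r' < u' i" using r'(2) i by (auto simp: B_def)
      then show ?thesis using 2 by simp
    qed
  qed
  then show ?thesis by blast
qed

text \<open>A form with nonzero slope in \<open>x\<close> changes sign only at its root, so only the
  position of a witness among the roots matters. Differences of roots record their order without
  mentioning \<open>x\<close>, and forms with slope zero are kept; a witness for \<open>e\<close>
  can then be moved to \<open>e'\<close>.\<close>

lemma signs_determine_FEx:
  assumes S: "finite S" "\<forall>L\<in>S. affine_form L" "signs_determine S \<phi>"
  shows "\<exists>S'. finite S' \<and> (\<forall>L\<in>S'. affine_form L) \<and> signs_determine S' (FEx x \<phi>)"
proof -
  define S0 where "S0 = {L\<in>S. slope x L = 0}"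
  define S1 where "S1 = {L\<in>S. slope x L \<noteq> 0}"
  define S' where "S' = S0 \<union> (\<lambda>(L, M) e. form_root x L e - form_root x M e) ` (S1 \<times> S1)"
  have S01: "S0 \<subseteq> S" "S1 \<subseteq> S"
    by (auto simp: S0_def S1_def)
  have fin: "finite S0" "finite S1"
    using S(1) S01 finite_subset by auto
  have aff: "affine_form L" if "L \<in> S'" for L
    using that S(2) S01 by (auto simp: S'_def intro!: affine_form_diff affine_form_form_root)
  have step: "sat e' (FEx x \<phi>)"
    if e: "\<forall>L\<in>S'. sgn (L e) = sgn (L e')" and sat: "sat e (FEx x \<phi>)" for e e'
  proof -
    from sat obtain r where r: "sat (e(x := r)) \<phi>" by auto
    have "sgn (form_root x L e - form_root x M e) = sgn (form_root x L e' - form_root x M e')"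
      if "L \<in> S1" "M \<in> S1" for L M
    proof -
      have "(\<lambda>e. form_root x L e - form_root x M e) \<in> S'"
        using that by (force simp: S'_def)
      from bspec[OF e this] show ?thesis .
    qed
    from exists_same_position[OF fin(2), where u = "\<lambda>L. form_root x L e"
        and u' = "\<lambda>L. form_root x L e'" and r = r, OF this] obtain r'
      where r': "\<forall>L\<in>S1. sgn (r - form_root x L e) = sgn (r' - form_root x L e')"
      by blast
    have "sgn (L (e(x := r))) = sgn (L (e'(x := r')))" if L: "L \<in> S" for L
    proof (cases "slope x L = 0")
      case True
      then have "sgn (L e) = sgn (L e')"
        using e L by (auto simp: S'_def S0_def)
      then show ?thesis
        using True S(2) L by (simp add: affine_form_upd)
    next
      case False
      then have "L \<in> S1" using L by (simp add: S1_def)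
      then show ?thesis
        using False S(2) L r' by (simp add: affine_form_eq_form_root sgn_mult)
    qed
    then have "sat (e'(x := r')) \<phi>"
      using S(3) r unfolding signs_determine_def by blast
    then show ?thesis by auto
  qed
  have "signs_determine S' (FEx x \<phi>)"
    unfolding signs_determine_def
  proof (intro allI impI)
    fix e e' assume "\<forall>L\<in>S'. sgn (L e) = sgn (L e')"
    then show "sat e (FEx x \<phi>) = sat e' (FEx x \<phi>)"
      using step[of e e'] step[of e' e] by auto
  qed
  moreover have "finite S'"
    using fin by (simp add: S'_def)
  ultimately show ?thesis
    using aff by blast
qed

lemma exists_signs_determine:
  "\<exists>S. finite S \<and> (\<forall>L\<in>S. affine_form L) \<and> signs_determine S \<phi>"
proof (induction \<phi>)
  case (FEq s t)
  show ?case
    by (rule exI[of _ "{\<lambda>e. trm_val e s - trm_val e t}"])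
       (auto simp: affine_form_diff affine_form_trm_val signs_determine_def sgn_if
          split: if_splits)
next
  case (FLess s t)
  show ?case
    by (rule exI[of _ "{\<lambda>e. trm_val e s - trm_val e t}"])
       (auto simp: affine_form_diff affine_form_trm_val signs_determine_def sgn_if
          split: if_splits)
next
  case (FNot \<phi>)
  then show ?case by (simp add: signs_determine_def)
next
  case (FAnd \<phi> \<psi>)
  then obtain S T where "finite S" "\<forall>L\<in>S. affine_form L" "signs_determine S \<phi>"
    "finite T" "\<forall>L\<in>T. affine_form L" "signs_determine T \<psi>"
    by blast
  then show ?case
    by (intro exI[of _ "S \<union> T"]) (simp add: signs_determine_def ball_Un, metis)
next
  case (FEx x \<phi>)
  then show ?case using signs_determine_FEx by blast
qed

section \<open>Unary semilinear functions near infinity\<close>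

text \<open>The graph of \<open>f\<close> is covered by finitely many lines, the zero sets of forms.
  Far along \<open>F\<close> no form changes sign on any of them, so a line that meets the graph
  once there carries all of it there. The hypothesis on signs treats \<open>at_top\<close> and
  \<open>at_bot\<close> at once.\<close>

lemma unary_semilinear_eventually_affine:
  fixes F :: "real filter"
  assumes f: "unary_semilinear f" and F: "F \<noteq> bot"
    and const_sgn: "\<And>a b. \<exists>s. eventually (\<lambda>x. sgn (a * x + b) = s) F"
  shows "\<exists>a b. eventually (\<lambda>x. f x = a * x + b) F"
proof -
  define e where "e x y = (\<lambda>_. 0 :: real)(0 := x, Suc 0 := y)" for x y
  from f obtain \<phi> where "\<forall>e. sat e \<phi> \<longleftrightarrow> e 1 = f (e 0)"
    by (auto simp: unary_semilinear_def)
  then have sat: "sat (e x y) \<phi> \<longleftrightarrow> y = f x" for x y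
    by (simp add: e_def)
  obtain S where S: "finite S" "\<forall>L\<in>S. affine_form L" "signs_determine S \<phi>"
    using exists_signs_determine by blast
  define \<alpha> where "\<alpha> L = slope 0 L" for L
  define \<beta> where "\<beta> L = slope (Suc 0) L" for L
  define \<gamma> where "\<gamma> L = L (\<lambda>_. 0)" for L :: "(nat \<Rightarrow> real) \<Rightarrow> real"
  have L_eq: "L (e x y) = \<alpha> L * x + \<beta> L * y + \<gamma> L" if "L \<in> S" for L x y
    using S(2) that by (simp add: e_def affine_form_upd \<alpha>_def \<beta>_def \<gamma>_def)
  have cong: "y = f x \<longleftrightarrow> y' = f x'"
    if "\<forall>L\<in>S. sgn (L (e x y)) = sgn (L (e x' y'))" for x y x' y'
    using S(3) that unfolding signs_determine_def sat[symmetric] by blast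
  \<comment> \<open>For \<open>\<beta> M \<noteq> 0\<close> this is the line where \<open>M\<close>
    vanishes; for \<open>\<beta> M = 0\<close> division by zero makes it the zero function.\<close>
  define g where "g M x = - (\<alpha> M / \<beta> M) * x - \<gamma> M / \<beta> M" for M x
  \<comment> \<open>If no form involving the value vanishes at \<open>(x, f x)\<close>, the value can be perturbed.\<close>
  have on_line: "\<exists>M\<in>S. \<beta> M \<noteq> 0 \<and> f x = g M x" for x
  proof (rule ccontr)
    assume "\<not> ?thesis"
    then have "f x \<noteq> g L x" if "L \<in> S" "\<beta> L \<noteq> 0" for L
      using that by blast
    moreover have "L (e x (f x)) = \<beta> L * (f x - g L x)" if "L \<in> S" "\<beta> L \<noteq> 0" for L
      using that(2) by (simp add: L_eq[OF that(1)] g_def algebra_simps)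
    ultimately have nz: "L (e x (f x)) \<noteq> 0" if "L \<in> S" "\<beta> L \<noteq> 0" for L
      using that by (metis diff_eq_diff_eq diff_self mult_eq_0_iff right_minus_eq)
    \<comment> \<open>Forms with \<open>\<beta> L = 0\<close> ignore \<open>y\<close>; the others
      are nonzero at \<open>f x\<close> and keep their sign nearby by continuity.\<close>
    have "eventually (\<lambda>y. \<forall>L\<in>S. sgn (L (e x y)) = sgn (L (e x (f x)))) (at_right (f x))"
    proof (rule eventually_ball_finite[OF S(1)], intro ballI)
      fix L assume L: "L \<in> S"
      show "eventually (\<lambda>y. sgn (L (e x y)) = sgn (L (e x (f x)))) (at_right (f x))"
      proof (cases "\<beta> L = 0")
        case True
        then show ?thesis using L by (simp add: L_eq)
      next
        case False
        have lim: "((\<lambda>y. L (e x y)) \<longlongrightarrow> L (e x (f x))) (at_right (f x))"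
          unfolding L_eq[OF L] by (intro tendsto_intros)
        show ?thesis
        proof (cases "L (e x (f x)) > 0")
          case True
          then show ?thesis
            using order_tendstoD(1)[OF lim True] by (auto elim: eventually_mono)
        next
          case neg: False
          then have "L (e x (f x)) < 0" using nz[OF L False] by simp
          then show ?thesis
            using order_tendstoD(2)[OF lim, of 0] by (auto elim: eventually_mono)
        qed
      qed
    qed
    moreover have "eventually (\<lambda>y. y > f x) (at_right (f x))"
      by (simp add: eventually_at_right_less)
    ultimately have "eventually (\<lambda>y. y > f x \<and>
        (\<forall>L\<in>S. sgn (L (e x y)) = sgn (L (e x (f x))))) (at_right (f x))"
      by eventually_elim simp
    then obtain y where y: "y > f x" "\<forall>L\<in>S. sgn (L (e x y)) = sgn (L (e x (f x)))"
      using eventually_happens'[OF trivial_limit_at_right_real] by blast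
    from cong[OF y(2)] y(1) show False
      by simp
  qed
  have "\<exists>s. eventually (\<lambda>x. sgn (L (e x (g M x))) = s) F" if "L \<in> S" for L M
  proof -
    have "L (e x (g M x)) = (\<alpha> L - \<beta> L * (\<alpha> M / \<beta> M)) * x + (\<gamma> L - \<beta> L * (\<gamma> M / \<beta> M))" for x
      by (simp add: L_eq[OF that] g_def algebra_simps)
    then show ?thesis by (simp only: const_sgn)
  qed
  then obtain s where s: "\<And>L M. L \<in> S \<Longrightarrow> eventually (\<lambda>x. sgn (L (e x (g M x))) = s L M) F"
    by metis
  have ev: "eventually (\<lambda>x. \<forall>L\<in>S. \<forall>M\<in>S. sgn (L (e x (g M x))) = s L M) F"
    using S(1) s by (simp add: eventually_ball_finite)
  then obtain x0 where x0: "\<forall>L\<in>S. \<forall>M\<in>S. sgn (L (e x0 (g M x0))) = s L M"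
    using eventually_happens'[OF F] by blast
  \<comment> \<open>A line through the graph at the single point \<open>x0\<close> suffices: every
    \<open>x\<close> with the same signs along \<open>M\<close> has the value
    \<open>g M x\<close>.\<close>
  obtain M where M: "M \<in> S" "f x0 = g M x0"
    using on_line by blast
  have "eventually (\<lambda>x. f x = g M x) F"
    using ev
  proof eventually_elim
    case (elim x)
    then have "\<forall>L\<in>S. sgn (L (e x (g M x))) = sgn (L (e x0 (g M x0)))"
      using x0 M(1) by simp
    from cong[OF this] M(2) show ?case by simp
  qed
  then have "eventually (\<lambda>x. f x = - (\<alpha> M / \<beta> M) * x + - (\<gamma> M / \<beta> M)) F"
    by (simp add: g_def)
  then show ?thesis by blast
qed

lemma eventually_sgn_linear_at_top:
  fixes a b :: real
  shows "\<exists>s. eventually (\<lambda>x. sgn (a * x + b) = s) at_top"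
proof (cases "a = 0")
  case False
  have "eventually (\<lambda>x. sgn (a * x + b) = sgn a) at_top"
    using eventually_gt_at_top[of "\<bar>b\<bar> / \<bar>a\<bar>"]
  proof eventually_elim
    case (elim x)
    then have "\<bar>b\<bar> < \<bar>a\<bar> * x" using False by (simp add: field_simps)
    then show ?case by (auto simp: sgn_if abs_if not_less split: if_splits)
  qed
  then show ?thesis by blast
qed simp

lemma eventually_sgn_linear_at_bot:
  fixes a b :: real
  shows "\<exists>s. eventually (\<lambda>x. sgn (a * x + b) = s) at_bot"
  using eventually_sgn_linear_at_top[of "- a" b]
  by (simp add: at_bot_mirror eventually_filtermap)

section \<open>Real polynomials at large arguments\<close>

lemma filterlim_poly_at_top:
  fixes q :: "real poly"
  assumes "degree q > 0" "lead_coeff q > 0"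
  shows "filterlim (poly q) at_top at_top"
  unfolding filterlim_at_top
proof
  fix Z :: real
  have lc: "lead_coeff (q + [:- Z:]) = lead_coeff q"
    using assms(1) degree_add_eq_left[of "[:- Z:]" q]
    by (simp add: coeff_pCons split: nat.split)
  obtain n where "\<forall>x\<ge>n. lead_coeff q \<le> poly (q + [:- Z:]) x"
    using poly_pinfty_gt_lc[of "q + [:- Z:]"] assms(2) lc by auto
  then have "\<forall>x\<ge>n. Z \<le> poly q x"
    using assms(2) by fastforce
  then show "eventually (\<lambda>x. Z \<le> poly q x) at_top"
    by (auto simp: eventually_at_top_linorder)
qed

text \<open>The order on \<open>real poly\<close> looks at the leading coefficient of the
  difference, which governs the values at large arguments.\<close>

lemma eventually_poly_mono:
  fixes q r :: "real poly"
  assumes "q \<le> r"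
  shows "eventually (\<lambda>t. poly q t \<le> poly r t) at_top"
proof (cases "q = r")
  case False
  then have "lead_coeff (r - q) > 0"
    using assms by (simp add: less_eq_poly_def pos_poly_def)
  then obtain n where "\<forall>x\<ge>n. lead_coeff (r - q) \<le> poly (r - q) x"
    using poly_pinfty_gt_lc by blast
  then have "\<forall>x\<ge>n. poly q x \<le> poly r x"
    using \<open>lead_coeff (r - q) > 0\<close> by fastforce
  then show ?thesis
    by (auto simp: eventually_at_top_linorder)
qed simp

text \<open>This lets max aggregation be computed on polynomials: the largest one eventually bounds
  the values of the finitely many others.\<close>

lemma eventually_poly_Max:
  fixes S :: "'i \<Rightarrow> real poly"
  assumes "finite I" "I \<noteq> {}"
  shows "eventually (\<lambda>t. poly (Max (S ` I)) t = Max ((\<lambda>i. poly (S i) t) ` I)) at_top"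
proof -
  have fin: "finite (S ` I)" "S ` I \<noteq> {}"
    using assms by auto
  then obtain m where m: "m \<in> I" "Max (S ` I) = S m"
    using Max_in by blast
  have "S i \<le> S m" if "i \<in> I" for i
    using Max_ge[OF fin(1)] that m(2) by force
  then have "eventually (\<lambda>t. \<forall>i\<in>I. poly (S i) t \<le> poly (S m) t) at_top"
    using assms(1) by (intro eventually_ball_finite) (auto intro: eventually_poly_mono)
  then show ?thesis
  proof eventually_elim
    case (elim t)
    show ?case
      using elim m assms(1) by (intro Max_eqI[symmetric]) auto
  qed
qed

section \<open>Polynomial shape of the embeddings\<close>

text \<open>The degrees in \<open>{a..b}\<close> are reserved for the keys of the leaves
  \<open>a\<close> to \<open>b\<close>. A nonzero polynomial avoiding them has its degree outside,
  so it dominates \<open>t ^ v\<close> for all \<open>v\<close> in the interval or for none.\<close>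

definition avoids :: "nat \<Rightarrow> nat \<Rightarrow> real poly \<Rightarrow> bool" where
  "avoids a b q \<longleftrightarrow> (\<forall>j\<in>{a..b}. coeff q j = 0)"

text \<open>The shape of an embedding coordinate of the leaf with key \<open>t ^ v\<close>, for \<open>v\<close> in \<open>{a..b}\<close>:
  the label \<open>l\<close> of the leaf only influences the constant coefficient.\<close>

definition uniform_on :: "nat \<Rightarrow> nat \<Rightarrow> (nat \<Rightarrow> bool \<Rightarrow> real poly) \<Rightarrow> bool" where
  "uniform_on a b y \<longleftrightarrow>
     (\<exists>A B c. avoids a b B \<and> coeff B 0 = 0 \<and>
        (\<forall>v\<in>{a..b}. \<forall>l. y v l = monom A v + B + [:c l:]))"

lemma uniform_onI:
  assumes "avoids a b B" "coeff B 0 = 0"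
    and "\<And>v l. v \<in> {a..b} \<Longrightarrow> y v l = monom A v + B + [:c l:]"
  shows "uniform_on a b y"
  using assms unfolding uniform_on_def by blast

lemma avoids_const: "1 \<le> a \<Longrightarrow> avoids a b [:c:]"
  by (auto simp: avoids_def coeff_pCons split: nat.split)

lemma avoids_add: "avoids a b q \<Longrightarrow> avoids a b r \<Longrightarrow> avoids a b (q + r)"
  by (simp add: avoids_def)

lemma avoids_smult: "avoids a b q \<Longrightarrow> avoids a b (smult c q)"
  by (simp add: avoids_def)

lemma avoids_sum: "(\<And>j. j \<in> J \<Longrightarrow> avoids a b (q j)) \<Longrightarrow> avoids a b (sum q J)"
  by (simp add: avoids_def coeff_sum)

lemma avoids_subset: "avoids a b q \<Longrightarrow> a \<le> a' \<Longrightarrow> b' \<le> b \<Longrightarrow> avoids a' b' q"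
  by (auto simp: avoids_def)

lemma uniform_on_subset: "uniform_on a b y \<Longrightarrow> a \<le> a' \<Longrightarrow> b' \<le> b \<Longrightarrow> uniform_on a' b' y"
  unfolding uniform_on_def by (meson atLeastAtMost_iff avoids_subset order_trans)

lemma uniform_on_avoids:
  assumes "1 \<le> a" "avoids a b q"
  shows "uniform_on a b (\<lambda>_ _. q)"
\<comment> \<open>The constant coefficient moves into \<open>c\<close>, as \<open>uniform_on\<close>
  requires \<open>coeff B 0 = 0\<close>.\<close>
proof (rule uniform_onI[where A = 0 and B = "q + [:- coeff q 0:]" and c = "\<lambda>_. coeff q 0"])
  show "avoids a b (q + [:- coeff q 0:])"
    by (rule avoids_add[OF assms(2) avoids_const[OF assms(1)]])
qed simp_all

lemma uniform_on_const: "uniform_on a b (\<lambda>_ l. [:c l:])"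
  by (rule uniform_onI[where A = 0 and B = 0 and c = c]) (simp_all add: avoids_def)

lemma uniform_on_add:
  assumes "uniform_on a b y" "uniform_on a b z"
  shows "uniform_on a b (\<lambda>v l. y v l + z v l)"
proof -
  obtain A B c where y: "avoids a b B" "coeff B 0 = 0"
      "\<forall>v\<in>{a..b}. \<forall>l. y v l = monom A v + B + [:c l:]"
    using assms(1) unfolding uniform_on_def by blast
  obtain A' B' c' where z: "avoids a b B'" "coeff B' 0 = 0"
      "\<forall>v\<in>{a..b}. \<forall>l. z v l = monom A' v + B' + [:c' l:]"
    using assms(2) unfolding uniform_on_def by blast
  show ?thesis
    by (rule uniform_onI[where A = "A + A'" and B = "B + B'" and c = "\<lambda>l. c l + c' l"])
       (use y z in \<open>simp_all add: avoids_add add_monom[symmetric]\<close>)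
qed

lemma uniform_on_smult:
  assumes "uniform_on a b y"
  shows "uniform_on a b (\<lambda>v l. smult d (y v l))"
proof -
  obtain A B c where y: "avoids a b B" "coeff B 0 = 0"
      "\<forall>v\<in>{a..b}. \<forall>l. y v l = monom A v + B + [:c l:]"
    using assms(1) unfolding uniform_on_def by blast
  show ?thesis
    by (rule uniform_onI[where A = "d * A" and B = "smult d B" and c = "\<lambda>l. d * c l"])
       (use y in \<open>simp_all add: avoids_smult smult_add_right smult_monom\<close>)
qed

lemma uniform_on_sum:
  "finite J \<Longrightarrow> (\<And>j. j \<in> J \<Longrightarrow> uniform_on a b (y j)) \<Longrightarrow>
     uniform_on a b (\<lambda>v l. \<Sum>j\<in>J. y j v l)"
proof (induction J rule: finite_induct)
  case empty
  then show ?case using uniform_on_const[of a b "\<lambda>_. 0"] by simp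
next
  case (insert j J)
  then show ?case by (simp add: uniform_on_add)
qed

text \<open>A nonzero \<open>B\<close> has its degree below \<open>a\<close> or above
  \<open>b\<close>, so either \<open>A\<close> or \<open>B\<close> supplies the leading coefficient,
  the same one for all leaves. As \<open>B\<close> has no constant term, the constant with the label
  dominates only if \<open>A\<close> and \<open>B\<close> are both zero.\<close>

lemma uniform_on_sign:
  assumes "1 \<le> a" "uniform_on a b y"
  obtains (const) c where "\<And>v l. v \<in> {a..b} \<Longrightarrow> y v l = [:c l:]"
  | (pos) "\<And>v l. v \<in> {a..b} \<Longrightarrow> degree (y v l) > 0 \<and> lead_coeff (y v l) > 0"
  | (neg) "\<And>v l. v \<in> {a..b} \<Longrightarrow> degree (y v l) > 0 \<and> lead_coeff (y v l) < 0"
proof -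
  obtain A B c where B: "avoids a b B" "coeff B 0 = 0"
    and y: "\<forall>v\<in>{a..b}. \<forall>l. y v l = monom A v + B + [:c l:]"
    using assms(2) unfolding uniform_on_def by blast
  have B_deg: "degree B > 0" if "B \<noteq> 0"
    using that B(2) by (metis gr0I leading_coeff_0_iff)
  have B_out: "degree B \<notin> {a..b}" if "B \<noteq> 0"
    using that B(1) unfolding avoids_def by (metis leading_coeff_0_iff)
  have const_add: "degree (q + [:d:]) = degree q \<and> lead_coeff (q + [:d:]) = lead_coeff q"
    if "degree q > 0" for q :: "real poly" and d
    using that degree_add_eq_left[of "[:d:]" q]
    by (auto simp: coeff_pCons split: nat.split)
  consider "A = 0" "B = 0" | "A \<noteq> 0" "B = 0 \<or> degree B < a" | "B \<noteq> 0" "A = 0 \<or> b < degree B"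
    using B_out by fastforce
  then show thesis
  proof cases
    case 1
    then show thesis using y const by simp
  next
    case 2
    have "degree (y v l) > 0 \<and> lead_coeff (y v l) = A" if v: "v \<in> {a..b}" for v l
    proof -
      define q where "q = monom A v + B"
      have "degree B < v"
        using 2(2) v assms(1) by auto
      then have "degree q = v" "coeff q v = A"
        using 2(1) by (simp_all add: q_def degree_add_eq_left degree_monom_eq coeff_eq_0)
      moreover have "y v l = q + [:c l:]"
        using y v by (simp add: q_def)
      ultimately show ?thesis
        using const_add[of q "c l"] v assms(1) by (auto simp del: coeff_add)
    qed
    then show thesis
      using 2(1) pos neg by (metis linorder_neqE_linordered_idom)
  next
    case 3
    have "degree (y v l) > 0 \<and> lead_coeff (y v l) = lead_coeff B" if v: "v \<in> {a..b}" for v l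
    proof -
      define q where "q = monom A v + B"
      have lt: "degree (monom A v) < degree B"
        using 3 v B_deg by (auto intro: le_less_trans[OF degree_monom_le])
      then have "degree q = degree B" "coeff q (degree B) = lead_coeff B"
        by (simp_all add: q_def degree_add_eq_right coeff_eq_0 del: coeff_monom)
      moreover have "y v l = q + [:c l:]"
        using y v by (simp add: q_def)
      ultimately show ?thesis
        using const_add[of q "c l"] v B_deg[OF 3(1)] by (auto simp del: coeff_add)
    qed
    moreover have "lead_coeff B \<noteq> 0" using 3(1) by simp
    ultimately show thesis
      using pos neg by (metis linorder_neqE_linordered_idom)
  qed
qed

lemma uniform_on_cong:
  assumes "\<And>v l. v \<in> {a..b} \<Longrightarrow> y v l = z v l"
  shows "uniform_on a b y \<longleftrightarrow> uniform_on a b z"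
  using assms by (simp add: uniform_on_def)

text \<open>A nonconstant polynomial tends to plus or minus infinity, where \<open>\<sigma>\<close>
  is affine, so for large \<open>t\<close> the result is a polynomial again; a constant stays
  constant. By \<open>uniform_on_sign\<close> all leaves of the interval take the same branch of
  \<open>\<Phi>\<close>, so they again share \<open>A\<close> and \<open>B\<close>.\<close>

lemma unary_semilinear_poly:
  assumes \<sigma>: "unary_semilinear \<sigma>"
  shows "\<exists>\<Phi>. (\<forall>q. eventually (\<lambda>t. \<sigma> (poly q t) = poly (\<Phi> q) t) at_top) \<and>
    (\<forall>a b q. 1 \<le> a \<longrightarrow> avoids a b q \<longrightarrow> avoids a b (\<Phi> q)) \<and>
    (\<forall>a b y. 1 \<le> a \<longrightarrow> uniform_on a b y \<longrightarrow> uniform_on a b (\<lambda>v l. \<Phi> (y v l)))"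
proof -
  obtain a1 b1 where top: "eventually (\<lambda>x. \<sigma> x = a1 * x + b1) at_top"
    using unary_semilinear_eventually_affine[OF \<sigma> _ eventually_sgn_linear_at_top] by auto
  obtain a2 b2 where bot: "eventually (\<lambda>x. \<sigma> x = a2 * x + b2) at_bot"
    using unary_semilinear_eventually_affine[OF \<sigma> _ eventually_sgn_linear_at_bot] by auto
  define \<Phi> where "\<Phi> q = (if degree q = 0 then [:\<sigma> (coeff q 0):]
    else if lead_coeff q > 0 then smult a1 q + [:b1:] else smult a2 q + [:b2:])" for q
  have \<Phi>_pos: "\<Phi> q = smult a1 q + [:b1:]" if "degree q > 0 \<and> lead_coeff q > 0" for q
    using that by (simp add: \<Phi>_def)
  have \<Phi>_neg: "\<Phi> q = smult a2 q + [:b2:]" if "degree q > 0 \<and> lead_coeff q < 0" for q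
    using that by (simp add: \<Phi>_def)
  have "eventually (\<lambda>t. \<sigma> (poly q t) = poly (\<Phi> q) t) at_top" for q
  proof -
    consider "degree q = 0" | "degree q > 0" "lead_coeff q > 0" | "degree q > 0" "lead_coeff q < 0"
      by (metis gr0I leading_coeff_0_iff degree_0 linorder_neqE_linordered_idom)
    then show ?thesis
    proof cases
      case 1
      then obtain d where "q = [:d:]" by (metis degree_eq_zeroE)
      then show ?thesis by (simp add: \<Phi>_def)
    next
      case 2
      then show ?thesis
        using filterlim_iff[THEN iffD1, OF filterlim_poly_at_top[OF 2], rule_format, OF top]
        by (simp add: \<Phi>_def algebra_simps)
    next
      case 3
      have "poly (- q) = (\<lambda>t. - poly q t)"
        by (simp add: fun_eq_iff)
      then have "filterlim (\<lambda>t. - poly q t) at_top at_top"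
        using filterlim_poly_at_top[of "- q"] 3 by simp
      then have "filterlim (poly q) at_bot at_top"
        by (simp add: filterlim_uminus_at_bot)
      from filterlim_iff[THEN iffD1, OF this, rule_format, OF bot] show ?thesis
        using 3 by (simp add: \<Phi>_def algebra_simps)
    qed
  qed
  moreover have "avoids a b (\<Phi> q)" if "1 \<le> a" "avoids a b q" for a b q
    using that by (simp add: \<Phi>_def avoids_add avoids_smult avoids_const)
  moreover have "uniform_on a b (\<lambda>v l. \<Phi> (y v l))" if a: "1 \<le> a" and y: "uniform_on a b y" for a b y
    using a y
  proof (cases rule: uniform_on_sign)
    case (const c)
    then have "uniform_on a b (\<lambda>v l. \<Phi> (y v l)) \<longleftrightarrow> uniform_on a b (\<lambda>v l. [:\<sigma> (c l):])"
      by (intro uniform_on_cong) (simp add: \<Phi>_def)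
    then show ?thesis using uniform_on_const by simp
  next
    case pos
    then have "uniform_on a b (\<lambda>v l. \<Phi> (y v l)) \<longleftrightarrow>
        uniform_on a b (\<lambda>v l. smult a1 (y v l) + [:b1:])"
      by (intro uniform_on_cong \<Phi>_pos)
    then show ?thesis using uniform_on_add uniform_on_smult uniform_on_const y by simp
  next
    case neg
    then have "uniform_on a b (\<lambda>v l. \<Phi> (y v l)) \<longleftrightarrow>
        uniform_on a b (\<lambda>v l. smult a2 (y v l) + [:b2:])"
      by (intro uniform_on_cong \<Phi>_neg)
    then show ?thesis using uniform_on_add uniform_on_smult uniform_on_const y by simp
  qed
  ultimately show ?thesis by blast
qed

section \<open>Feedforward networks acting on polynomials\<close>

definition poly_vec :: "nat \<Rightarrow> (nat \<Rightarrow> real poly) \<Rightarrow> real \<Rightarrow> real vec" where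
  "poly_vec k x t = vec k (\<lambda>j. poly (x j) t)"

text \<open>\<open>F\<close> is a symbolic version of \<open>f\<close> on coordinates that are
  polynomials in \<open>t\<close>. The threshold for \<open>t\<close> may depend on
  \<open>x\<close>, since only finitely many inputs occur in a layer. One \<open>F\<close> serves
  all leaves, so that their common shape survives.\<close>

definition poly_lift ::
  "nat \<Rightarrow> nat \<Rightarrow> (real vec \<Rightarrow> real vec) \<Rightarrow> ((nat \<Rightarrow> real poly) \<Rightarrow> nat \<Rightarrow> real poly) \<Rightarrow> bool" where
  "poly_lift k m f F \<longleftrightarrow>
     (\<forall>x. eventually (\<lambda>t. f (poly_vec k x t) = poly_vec m (F x) t) at_top) \<and>
     (\<forall>a b x. 1 \<le> a \<longrightarrow> (\<forall>j<k. avoids a b (x j)) \<longrightarrow> (\<forall>i<m. avoids a b (F x i))) \<and>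
     (\<forall>a b y. 1 \<le> a \<longrightarrow> (\<forall>j<k. uniform_on a b (y j)) \<longrightarrow>
        (\<forall>i<m. uniform_on a b (\<lambda>v l. F (\<lambda>j. y j v l) i)))"

lemma rational_affine_poly_lift:
  assumes "rational_affine k m f"
  shows "\<exists>F. poly_lift k m f F"
proof -
  obtain M b where M: "M \<in> carrier_mat m k" "b \<in> carrier_vec m"
    and f: "\<forall>x\<in>carrier_vec k. f x = M *\<^sub>v x + b"
    using assms unfolding rational_affine_def by blast
  define F where "F x i = (\<Sum>j<k. smult (M $$ (i, j)) (x j)) + [:b $ i:]" for x i
  have "f (poly_vec k x t) = poly_vec m (F x) t" for x t
  proof -
    have "poly_vec k x t \<in> carrier_vec k" by (simp add: poly_vec_def)
    then have "f (poly_vec k x t) = M *\<^sub>v poly_vec k x t + b" using f by blast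
    also have "\<dots> = poly_vec m (F x) t"
      using M by (intro eq_vecI)
        (auto simp: poly_vec_def F_def scalar_prod_def poly_sum lessThan_atLeast0 algebra_simps)
    finally show ?thesis .
  qed
  moreover have "avoids a b' (F x i)" if "1 \<le> a" "\<forall>j<k. avoids a b' (x j)" for a b' x i
    using that by (auto simp: F_def intro!: avoids_add avoids_sum avoids_smult avoids_const)
  moreover have "uniform_on a b' (\<lambda>v l. F (\<lambda>j. y j v l) i)" if "\<forall>j<k. uniform_on a b' (y j)" for a b' y i
    using that unfolding F_def
    by (auto intro!: uniform_on_add uniform_on_sum uniform_on_smult uniform_on_const)
  ultimately show ?thesis
    unfolding poly_lift_def by (intro exI[of _ F]) auto
qed

lemma coordinatewise_poly_lift:
  assumes "coordinatewise {f. unary_semilinear f} k f"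
  shows "\<exists>F. poly_lift k k f F"
proof -
  obtain \<sigma> where \<sigma>: "\<forall>i<k. unary_semilinear (\<sigma> i)"
    and f: "\<forall>x\<in>carrier_vec k. f x = vec k (\<lambda>i. \<sigma> i (x $ i))"
    using assms unfolding coordinatewise_def by auto
  have "\<forall>i. \<exists>\<Phi>. i < k \<longrightarrow> (\<forall>q. eventually (\<lambda>t. \<sigma> i (poly q t) = poly (\<Phi> q) t) at_top) \<and>
    (\<forall>a b q. 1 \<le> a \<longrightarrow> avoids a b q \<longrightarrow> avoids a b (\<Phi> q)) \<and>
    (\<forall>a b y. 1 \<le> a \<longrightarrow> uniform_on a b y \<longrightarrow> uniform_on a b (\<lambda>v l. \<Phi> (y v l)))"
    using unary_semilinear_poly \<sigma> by blast
  from choice[OF this] obtain \<Phi> where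
    \<Phi>: "\<And>i q. i < k \<Longrightarrow> eventually (\<lambda>t. \<sigma> i (poly q t) = poly (\<Phi> i q) t) at_top"
      "\<And>i a b q. i < k \<Longrightarrow> 1 \<le> a \<Longrightarrow> avoids a b q \<Longrightarrow> avoids a b (\<Phi> i q)"
      "\<And>i a b y. i < k \<Longrightarrow> 1 \<le> a \<Longrightarrow> uniform_on a b y \<Longrightarrow> uniform_on a b (\<lambda>v l. \<Phi> i (y v l))"
    by blast
  have "eventually (\<lambda>t. f (poly_vec k x t) = poly_vec k (\<lambda>i. \<Phi> i (x i)) t) at_top" for x
  proof -
    have "eventually (\<lambda>t. \<forall>i\<in>{..<k}. \<sigma> i (poly (x i) t) = poly (\<Phi> i (x i)) t) at_top"
      using \<Phi>(1) by (intro eventually_ball_finite) auto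
    then show ?thesis
      using f by (auto simp: poly_vec_def elim!: eventually_mono)
  qed
  then have "poly_lift k k f (\<lambda>x i. \<Phi> i (x i))"
    unfolding poly_lift_def using \<Phi>(2,3) by auto
  then show ?thesis by blast
qed

lemma feedforward_poly_lift:
  assumes "feedforward {f. unary_semilinear f} k m f"
  shows "\<exists>F. poly_lift k m f F"
  using assms
proof induction
  case (affine k m f)
  then show ?case by (rule rational_affine_poly_lift)
next
  case (activation k f)
  then show ?case by (rule coordinatewise_poly_lift)
next
  case (compose k l f m g h)
  then obtain F G where F: "poly_lift k l f F" and G: "poly_lift l m g G"
    by blast
  have "eventually (\<lambda>t. h (poly_vec k x t) = poly_vec m (G (F x)) t) at_top" for x
  proof -
    have "eventually (\<lambda>t. f (poly_vec k x t) = poly_vec l (F x) t) at_top"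
      "eventually (\<lambda>t. g (poly_vec l (F x) t) = poly_vec m (G (F x)) t) at_top"
      using F G unfolding poly_lift_def by blast+
    then show ?thesis
    proof eventually_elim
      case (elim t)
      have "h (poly_vec k x t) = g (f (poly_vec k x t))"
        using compose.hyps by (simp add: poly_vec_def)
      with elim show ?case by simp
    qed
  qed
  moreover have "avoids a b (G (F x) i)" if "1 \<le> a" "\<forall>j<k. avoids a b (x j)" "i < m" for a b x i
  proof -
    have "\<forall>j<l. avoids a b (F x j)" using F that unfolding poly_lift_def by blast
    then show ?thesis using G that unfolding poly_lift_def by blast
  qed
  moreover have "uniform_on a b (\<lambda>v l. G (F (\<lambda>j. y j v l)) i)"
    if "1 \<le> a" "\<forall>j<k. uniform_on a b (y j)" "i < m" for a b y i
  proof -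
    define z where "z i v l = F (\<lambda>j. y j v l) i" for i v l
    have "\<forall>j<l. uniform_on a b (z j)"
      using F that unfolding poly_lift_def z_def by blast
    then have "uniform_on a b (\<lambda>v l. G (\<lambda>j. z j v l) i)"
      using G that unfolding poly_lift_def by blast
    then show ?thesis by (simp add: z_def)
  qed
  ultimately have "poly_lift k m h (\<lambda>x. G (F x))"
    unfolding poly_lift_def by blast
  then show ?case by blast
qed

section \<open>Maxima over the leaves\<close>

lemma monom_add_pos:
  fixes q :: "real poly"
  assumes "A > 0" "degree q < v"
  shows "0 < monom A v + q"
proof -
  have "degree (monom A v + q) = v"
    using assms by (simp add: degree_add_eq_left degree_monom_eq)
  then show ?thesis
    using assms by (simp add: less_poly_def pos_poly_def coeff_eq_0)
qed

text \<open>If \<open>A > 0\<close> leaf \<open>b\<close> wins, if \<open>A < 0\<close> leaf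
  \<open>a\<close>; both are unlabeled, and their own degree drops out of the smaller interval. If
  \<open>A = 0\<close> only the constants differ, and both labels occur since \<open>S\<close> is
  nonempty and misses \<open>a\<close>. So \<open>z\<close> does not depend on
  \<open>S\<close>.\<close>

lemma uniform_on_Max:
  assumes y: "uniform_on a b y"
  shows "\<exists>z. avoids (Suc a) (b - 1) z \<and> (\<forall>S. S \<noteq> {} \<and> S \<subseteq> {a<..<b} \<longrightarrow>
    z \<in> (\<lambda>v. y v (v \<in> S)) ` {a..b} \<and> (\<forall>v\<in>{a..b}. y v (v \<in> S) \<le> z))"
proof (cases "Suc a < b")
  case False
  \<comment> \<open>No admissible \<open>S\<close> is left, so \<open>z = 0\<close> serves
    vacuously.\<close>
  then have "S = {}" if "S \<subseteq> {a<..<b}" for S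
    using that by auto
  then show ?thesis by (intro exI[of _ 0]) (auto simp: avoids_def)
next
  case ab: True
  obtain A B c where B: "avoids a b B"
    and yv: "\<And>v l. v \<in> {a..b} \<Longrightarrow> y v l = monom A v + B + [:c l:]"
    using y unfolding uniform_on_def by blast
  have const: "avoids (Suc a) (b - 1) [:d:]" for d
    by (rule avoids_const) simp
  have B': "avoids (Suc a) (b - 1) B"
    using B by (rule avoids_subset) auto
  consider "A > 0" | "A < 0" | "A = 0" by linarith
  then show ?thesis
  proof cases
    case 1
    have "y v (v \<in> S) \<le> y b False" if S: "S \<subseteq> {a<..<b}" and v: "v \<in> {a..b}" for S v
    proof (cases "v = b")
      case True
      then have "v \<notin> S" using S by auto
      then show ?thesis using True by simp
    next
      case False
      \<comment> \<open>This is the difference of the two values: the common \<open>B\<close>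
        cancels and the term of degree \<open>b\<close> dominates.\<close>
      have "0 < monom A b + ([:c False:] - monom A v - [:c (v \<in> S):])"
      proof (rule monom_add_pos[OF 1])
        have "degree (monom A v) < b"
          using False v by (auto intro: le_less_trans[OF degree_monom_le])
        then show "degree ([:c False:] - monom A v - [:c (v \<in> S):]) < b"
          using ab by (intro degree_diff_less) auto
      qed
      also have "\<dots> = y b False - y v (v \<in> S)"
        using v ab by (simp add: yv)
      finally show ?thesis by simp
    qed
    moreover have "y b False \<in> (\<lambda>v. y v (v \<in> S)) ` {a..b}" if S: "S \<subseteq> {a<..<b}" for S
    proof (rule image_eqI[of _ _ b])
      have "b \<notin> S" using S by auto
      then show "y b False = y b (b \<in> S)" by simp
    qed (use ab in simp)
    moreover have "avoids (Suc a) (b - 1) (y b False)"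
      using ab B' const by (auto simp: yv avoids_def intro!: avoids_add)
    ultimately show ?thesis by blast
  next
    case 2
    have "y v (v \<in> S) \<le> y a False" if S: "S \<subseteq> {a<..<b}" and v: "v \<in> {a..b}" for S v
    proof (cases "v = a")
      case True
      then have "v \<notin> S" using S by auto
      then show ?thesis using True by simp
    next
      case False
      have "0 < monom (- A) v + ([:c False:] + monom A a - [:c (v \<in> S):])"
      proof (rule monom_add_pos)
        have "degree (monom A a) < v"
          using False v by (auto intro: le_less_trans[OF degree_monom_le])
        moreover have "0 < v" using False v by auto
        ultimately show "degree ([:c False:] + monom A a - [:c (v \<in> S):]) < v"
          by (intro degree_diff_less degree_add_less) auto
      qed (use 2 in simp)
      also have "\<dots> = y a False - y v (v \<in> S)"
        using v ab by (simp add: yv minus_monom[symmetric])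
      finally show ?thesis by simp
    qed
    moreover have "y a False \<in> (\<lambda>v. y v (v \<in> S)) ` {a..b}" if S: "S \<subseteq> {a<..<b}" for S
    proof (rule image_eqI[of _ _ a])
      have "a \<notin> S" using S by auto
      then show "y a False = y a (a \<in> S)" by simp
    qed (use ab in simp)
    moreover have "avoids (Suc a) (b - 1) (y a False)"
      using ab B' const by (auto simp: yv avoids_def intro!: avoids_add)
    ultimately show ?thesis by blast
  next
    case 3
    define z where "z = B + [:max (c False) (c True):]"
    have y0: "y v l = B + [:c l:]" if "v \<in> {a..b}" for v l
      using that 3 yv by simp
    have le: "[:d:] \<le> [:d':]" if "d \<le> d'" for d d' :: real
      using that by (auto simp: less_eq_poly_def pos_poly_def)
    have "y v l \<le> z" if "v \<in> {a..b}" for v l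
      using that by (cases l) (auto simp: y0 z_def intro!: le)
    moreover have "z \<in> (\<lambda>v. y v (v \<in> S)) ` {a..b}" if S: "S \<noteq> {}" "S \<subseteq> {a<..<b}" for S
    proof -
      \<comment> \<open>The labeled leaf \<open>s\<close> and the unlabeled leaf \<open>a\<close>
        realize \<open>c True\<close> and \<open>c False\<close>, so the larger constant is
        attained.\<close>
      obtain s where s: "s \<in> S" "s \<in> {a..b}" "a \<notin> S" using S by fastforce
      have a: "a \<in> {a..b}" using ab by simp
      show ?thesis
      proof (cases "c False \<le> c True")
        case True
        then have "z = y s (s \<in> S)" using s by (simp add: z_def y0)
        then show ?thesis using s by blast
      next
        case False
        then have "z = y a (a \<in> S)" using s a by (simp add: z_def y0)
        then show ?thesis using a by blast
      qed
    qed
    moreover have "avoids (Suc a) (b - 1) z"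
      using B' const by (simp add: z_def avoids_add)
    ultimately show ?thesis by blast
  qed
qed

text \<open>Leaves outside \<open>{a..b}\<close> are unlabeled for every admissible \<open>S\<close>
  and contribute fixed polynomials; those inside are replaced by the single candidate
  \<open>z\<close> of \<open>uniform_on_Max\<close>. Hence one \<open>q\<close> works for all
  \<open>S\<close>, which hides \<open>S\<close> from the center.\<close>

lemma star_Max:
  assumes y: "uniform_on a b y" and ab: "{a..b} \<subseteq> {1..m}"
    and out: "\<And>v. v \<in> {1..m} - {a..b} \<Longrightarrow> avoids a b (y v False)"
  shows "\<exists>q. \<forall>S. S \<noteq> {} \<and> S \<subseteq> {a<..<b} \<longrightarrow>
    avoids (Suc a) (b - 1) q \<and> Max ((\<lambda>v. y v (v \<in> S)) ` {1..m}) = q"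
proof -
  from uniform_on_Max[OF y] obtain z where z: "avoids (Suc a) (b - 1) z"
    and "\<forall>S. S \<noteq> {} \<and> S \<subseteq> {a<..<b} \<longrightarrow>
      z \<in> (\<lambda>v. y v (v \<in> S)) ` {a..b} \<and> (\<forall>v\<in>{a..b}. y v (v \<in> S) \<le> z)"
    by (elim exE conjE)
  then have z_in: "z \<in> (\<lambda>v. y v (v \<in> S)) ` {a..b}"
    and z_ge: "\<forall>v\<in>{a..b}. y v (v \<in> S) \<le> z" if "S \<noteq> {}" "S \<subseteq> {a<..<b}" for S
    using that by auto
  define T where "T = insert z ((\<lambda>v. y v False) ` ({1..m} - {a..b}))"
  have T: "finite T" "T \<noteq> {}" by (auto simp: T_def)
  have "avoids (Suc a) (b - 1) q" if "q \<in> T" for q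
    using that z avoids_subset[OF out, of _ "Suc a" "b - 1"] by (auto simp: T_def)
  then have "avoids (Suc a) (b - 1) (Max T)"
    using Max_in[OF T] by blast
  moreover have "Max ((\<lambda>v. y v (v \<in> S)) ` {1..m}) = Max T" if S: "S \<noteq> {}" "S \<subseteq> {a<..<b}" for S
  proof (rule Max_eqI)
    fix x assume "x \<in> (\<lambda>v. y v (v \<in> S)) ` {1..m}"
    then obtain v where v: "v \<in> {1..m}" "x = y v (v \<in> S)" by blast
    show "x \<le> Max T"
    proof (cases "v \<in> {a..b}")
      case True
      then have "x \<le> z" using z_ge[OF S] v by simp
      also have "z \<le> Max T" using T by (intro Max_ge) (auto simp: T_def)
      finally show ?thesis .
    next
      case False
      then have "v \<notin> S" using S(2) by auto
      then have "x \<in> T" using False v by (simp add: T_def)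
      then show ?thesis using T by simp
    qed
  next
    have "T \<subseteq> (\<lambda>v. y v (v \<in> S)) ` {1..m}"
    proof
      fix x assume "x \<in> T"
      then consider "x = z" | v where "v \<in> {1..m} - {a..b}" "x = y v False"
        unfolding T_def by blast
      then show "x \<in> (\<lambda>v. y v (v \<in> S)) ` {1..m}"
      proof cases
        case 1
        then show ?thesis using z_in[OF S] ab by blast
      next
        case (2 v)
        moreover have "v \<notin> S" using S(2) 2(1) by auto
        ultimately show ?thesis by (intro image_eqI[of _ _ v]) simp_all
      qed
    qed
    then show "Max T \<in> (\<lambda>v. y v (v \<in> S)) ` {1..m}"
      using Max_in[OF T] by blast
  qed simp
  ultimately show ?thesis by blast
qed

section \<open>Star graphs and the layers acting on them\<close>

text \<open>\<open>g\<close> numbers nodes of an arbitrary type, with \<open>g 0\<close> as the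
  center; \<open>the_inv g\<close> recovers the number, so that labels and keys can be given by
  numbers.\<close>

definition star_graph :: "(nat \<Rightarrow> 'v) \<Rightarrow> nat \<Rightarrow> nat \<Rightarrow> nat \<Rightarrow> nat set \<Rightarrow> 'v graph" where
  "star_graph g m n p S =
     \<lparr>nodes = g ` {0..m},
      edges = (\<lambda>v. (g 0, g v)) ` {1..m} \<union> (\<lambda>v. (g v, g 0)) ` {1..m},
      lab = (\<lambda>u. vec n (\<lambda>i. if i = p \<and> the_inv g u \<in> S then 1 else 0))\<rparr>"

lemma is_graph_star_graph:
  assumes "inj g"
  shows "is_graph n (star_graph g m n p S)"
  unfolding is_graph_def star_graph_def
  by (auto simp: irrefl_def sym_def inj_eq[OF assms])

lemma neighbors_star_graph:
  assumes "inj g"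
  shows "neighbors (star_graph g m n p S) (g 0) = g ` {1..m}"
    and "v \<in> {1..m} \<Longrightarrow> neighbors (star_graph g m n p S) (g v) = {g 0}"
  unfolding neighbors_def star_graph_def by (auto simp: inj_eq[OF assms])

text \<open>A maximum sees only the support of a multiset. \<open>X\<close> is quantified inside the
  filter because the multiset of embeddings varies with \<open>t\<close>.\<close>

lemma coordinatewise_max_poly_vec:
  assumes "finite I" "I \<noteq> {}"
  shows "eventually (\<lambda>t. \<forall>X. set_mset X = (\<lambda>v. poly_vec d (x v) t) ` I \<longrightarrow>
    coordinatewise_max d X = poly_vec d (\<lambda>i. Max ((\<lambda>v. x v i) ` I)) t) at_top"
proof -
  have "eventually (\<lambda>t. \<forall>i\<in>{..<d}. poly (Max ((\<lambda>v. x v i) ` I)) t =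
      Max ((\<lambda>v. poly (x v i) t) ` I)) at_top"
    by (intro eventually_ball_finite ballI eventually_poly_Max assms) simp
  then show ?thesis
  proof eventually_elim
    case (elim t)
    show ?case
    proof (intro allI impI)
      fix X assume X: "set_mset X = (\<lambda>v. poly_vec d (x v) t) ` I"
      then have "X \<noteq> {#}" using assms(2) by auto
      moreover have "(\<lambda>u. u $ i) ` set_mset X = (\<lambda>v. poly (x v i) t) ` I" if "i < d" for i
        unfolding X image_image using that by (simp add: poly_vec_def)
      ultimately show "coordinatewise_max d X = poly_vec d (\<lambda>i. Max ((\<lambda>v. x v i) ` I)) t"
        using elim by (auto simp: coordinatewise_max_def poly_vec_def)
    qed
  qed
qed

lemma append_poly_vec:
  "poly_vec d x t @\<^sub>v poly_vec d y t = poly_vec (2 * d) (\<lambda>i. if i < d then x i else y (i - d)) t"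
  by (rule eq_vecI) (auto simp: poly_vec_def)

text \<open>\<open>P v l i\<close> is coordinate \<open>i\<close> of the embedding of node \<open>v\<close> if its label is \<open>l\<close>.\<close>

definition star_state :: "nat \<Rightarrow> nat \<Rightarrow> nat \<Rightarrow> nat \<Rightarrow> (nat \<Rightarrow> bool \<Rightarrow> nat \<Rightarrow> real poly) \<Rightarrow> bool" where
  "star_state m d a b P \<longleftrightarrow>
     (\<forall>v\<in>{0..m} - {a..b}. \<forall>i<d. avoids a b (P v False i)) \<and>
     (\<forall>i<d. uniform_on a b (\<lambda>v l. P v l i))"

text \<open>\<open>S\<close> enters only by selecting the label argument of \<open>P\<close>, so
  different graphs can be compared through one and the same \<open>P\<close>.\<close>

definition star_represents ::
  "(nat \<Rightarrow> 'v) \<Rightarrow> nat \<Rightarrow> nat set \<Rightarrow> nat \<Rightarrow> (real \<Rightarrow> 'v \<Rightarrow> real vec) \<Rightarrow>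
     (nat \<Rightarrow> bool \<Rightarrow> nat \<Rightarrow> real poly) \<Rightarrow> bool" where
  "star_represents g m S d emb P \<longleftrightarrow>
     eventually (\<lambda>t. \<forall>v\<in>{0..m}. emb t (g v) = poly_vec d (P v (v \<in> S)) t) at_top"

text \<open>Only the leaves \<open>a\<close> and \<open>b\<close> are newly outside, and their own
  terms have degree \<open>a\<close> or \<open>b\<close>, which the smaller interval no longer
  contains.\<close>

lemma star_state_shrink:
  assumes st: "star_state m d a b P" and "v \<in> {0..m} - {Suc a..b - 1}" "i < d"
  shows "avoids (Suc a) (b - 1) (P v False i)"
proof (cases "v \<in> {a..b}")
  case False
  then have "avoids a b (P v False i)"
    using assms by (simp add: star_state_def)
  then show ?thesis by (rule avoids_subset) auto
next
  case True
  obtain A B c where B: "avoids a b B"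
    and yv: "\<And>v l. v \<in> {a..b} \<Longrightarrow> P v l i = monom A v + B + [:c l:]"
    using st \<open>i < d\<close> unfolding star_state_def uniform_on_def by blast
  have "avoids (Suc a) (b - 1) (monom A v)"
    using assms(2) by (auto simp: avoids_def)
  moreover have "avoids (Suc a) (b - 1) B"
    using B by (rule avoids_subset) auto
  ultimately show ?thesis
    using True by (simp add: yv avoids_add avoids_const)
qed

text \<open>The center receives maxima that by \<open>star_Max\<close> do not depend on
  \<open>S\<close> and avoid the smaller interval. Each leaf receives only the embedding of the
  center, common to all leaves. So \<open>P'\<close> can be chosen before \<open>S\<close>, and
  \<open>C\<close> preserves the shape.\<close>

lemma star_layer_step:
  assumes g: "inj g" and m: "1 \<le> a" "b \<le> m" "a < b"
    and L: "in_dim L = d" "\<And>X. set_mset X \<subseteq> carrier_vec d \<Longrightarrow> agg L X = coordinatewise_max d X"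
    and C: "poly_lift (2 * d) (out_dim L) (com L) C"
    and st: "star_state m d a b P"
  shows "\<exists>P'. star_state m (out_dim L) (Suc a) (b - 1) P' \<and>
    (\<forall>S emb. S \<noteq> {} \<and> S \<subseteq> {a<..<b} \<and> star_represents g m S d emb P \<longrightarrow>
       star_represents g m S (out_dim L) (\<lambda>t. layer_step (star_graph g m n p S) L (emb t)) P')"
proof -
  have "\<exists>q. \<forall>S. S \<noteq> {} \<and> S \<subseteq> {a<..<b} \<longrightarrow>
      avoids (Suc a) (b - 1) q \<and> Max ((\<lambda>v. P v (v \<in> S) i) ` {1..m}) = q" if "i < d" for i
    using st that m by (intro star_Max[of a b "\<lambda>v l. P v l i"]) (auto simp: star_state_def)
  then obtain Q where Q0: "\<And>i S. i < d \<Longrightarrow> S \<noteq> {} \<Longrightarrow> S \<subseteq> {a<..<b} \<Longrightarrow>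
      avoids (Suc a) (b - 1) (Q i) \<and> Max ((\<lambda>v. P v (v \<in> S) i) ` {1..m}) = Q i"
    by metis
  have Q_max: "Max ((\<lambda>v. P v (v \<in> S) i) ` {1..m}) = Q i"
    if "i < d" "S \<noteq> {}" "S \<subseteq> {a<..<b}" for i S
    using Q0 that by blast
  \<comment> \<open>\<open>Q0\<close> needs an admissible \<open>S\<close>; \<open>{Suc a}\<close>
    is one, unless the smaller interval is empty and there is nothing to avoid.\<close>
  have Q_avoids: "avoids (Suc a) (b - 1) (Q i)" if "i < d" for i
  proof (cases "Suc a < b")
    case True
    then show ?thesis using Q0[OF that, of "{Suc a}"] by auto
  qed (auto simp: avoids_def)
  define cat where "cat x y i = (if i < d then x i else y (i - d))" for x y :: "nat \<Rightarrow> real poly" and i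
  \<comment> \<open>The center is never in \<open>S\<close>, because \<open>1 \<le> a\<close>; hence
    its label is always \<open>False\<close>.\<close>
  define P' where "P' v l = (if v = 0 then C (cat (P 0 False) Q) else C (cat (P v l) (P 0 False)))" for v l
  have P0: "avoids (Suc a) (b - 1) (P 0 False i)" if "i < d" for i
    using star_state_shrink[OF st, of 0 i] that by auto
  have C_avoids: "avoids (Suc a) (b - 1) (C x i)"
    if "\<forall>j<2*d. avoids (Suc a) (b - 1) (x j)" "i < out_dim L" for x i
    using C that unfolding poly_lift_def by auto
  have C_uniform: "uniform_on (Suc a) (b - 1) (\<lambda>v l. C (\<lambda>j. y j v l) i)"
    if "\<forall>j<2*d. uniform_on (Suc a) (b - 1) (y j)" "i < out_dim L" for y i
    using C that unfolding poly_lift_def by auto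
  have C_eval: "eventually (\<lambda>t. com L (poly_vec (2 * d) x t) = poly_vec (out_dim L) (C x) t) at_top" for x
    using C unfolding poly_lift_def by blast
  have "star_state m (out_dim L) (Suc a) (b - 1) P'"
    unfolding star_state_def
  proof (intro conjI ballI allI impI)
    fix v i assume v: "v \<in> {0..m} - {Suc a..b - 1}" and i: "i < out_dim L"
    have "\<forall>j<2*d. avoids (Suc a) (b - 1) (cat (P 0 False) Q j)"
      using Q_avoids P0 by (simp add: cat_def)
    moreover have "\<forall>j<2*d. avoids (Suc a) (b - 1) (cat (P v False) (P 0 False) j)"
      using star_state_shrink[OF st v] P0 by (simp add: cat_def)
    ultimately show "avoids (Suc a) (b - 1) (P' v False i)"
      unfolding P'_def using C_avoids[OF _ i] by (cases "v = 0") (simp_all del: One_nat_def)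
  next
    fix i assume i: "i < out_dim L"
    define y where "y j v l = cat (P v l) (P 0 False) j" for j v l
    have "uniform_on (Suc a) (b - 1) (y j)" if j: "j < 2 * d" for j
    proof (cases "j < d")
      case True
      then have "uniform_on a b (\<lambda>v l. P v l j)"
        using st by (simp add: star_state_def)
      then have "uniform_on (Suc a) (b - 1) (\<lambda>v l. P v l j)"
        by (rule uniform_on_subset) auto
      then show ?thesis using True by (simp add: y_def[abs_def] cat_def)
    next
      case False
      then have "uniform_on (Suc a) (b - 1) (\<lambda>_ _. P 0 False (j - d))"
        using j by (intro uniform_on_avoids P0) auto
      then show ?thesis using False by (simp add: y_def[abs_def] cat_def)
    qed
    then have "uniform_on (Suc a) (b - 1) (\<lambda>v l. C (\<lambda>j. y j v l) i)"
      using i by (intro C_uniform) auto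
    moreover have "uniform_on (Suc a) (b - 1) (\<lambda>v l. P' v l i) \<longleftrightarrow>
        uniform_on (Suc a) (b - 1) (\<lambda>v l. C (\<lambda>j. y j v l) i)"
      by (intro uniform_on_cong) (simp add: P'_def y_def)
    ultimately show "uniform_on (Suc a) (b - 1) (\<lambda>v l. P' v l i)" by simp
  qed
  moreover have "star_represents g m S (out_dim L) (\<lambda>t. layer_step (star_graph g m n p S) L (emb t)) P'"
    if S: "S \<noteq> {}" "S \<subseteq> {a<..<b}" and rep: "star_represents g m S d emb P" for S emb
  proof -
    have S0: "0 \<notin> S" using S(2) m by auto
    have ne: "{1..m} \<noteq> {}" using m by auto
    have "eventually (\<lambda>t. \<forall>v\<in>{0..m}. com L (poly_vec (2 * d) (cat (P v (v \<in> S)) (P 0 False)) t) =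
        poly_vec (out_dim L) (C (cat (P v (v \<in> S)) (P 0 False))) t) at_top"
      by (intro eventually_ball_finite ballI C_eval) simp
    then show ?thesis
      using rep[unfolded star_represents_def] C_eval[of "cat (P 0 False) Q"]
        coordinatewise_max_poly_vec[OF finite_atLeastAtMost ne, of d "\<lambda>v. P v (v \<in> S)"]
      unfolding star_represents_def
    proof eventually_elim
      case (elim t)
      have emb: "emb t (g v) = poly_vec d (P v (v \<in> S)) t" if "v \<in> {0..m}" for v
        using elim(2) that by blast
      have emb0: "emb t (g 0) = poly_vec d (P 0 False) t"
        using emb[of 0] S0 by simp
      have cv: "poly_vec d x t \<in> carrier_vec d" for x
        by (simp add: poly_vec_def)
      show ?case
      proof
        fix v assume v: "v \<in> {0..m}"
        show "layer_step (star_graph g m n p S) L (emb t) (g v) = poly_vec (out_dim L) (P' v (v \<in> S)) t"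
        proof (cases "v = 0")
          case True
          define X where "X = image_mset (emb t) (mset_set (g ` {1..m}))"
          have X: "set_mset X = (\<lambda>v. poly_vec d (P v (v \<in> S)) t) ` {1..m}"
            using emb by (auto simp: X_def image_image)
          have "agg L X = coordinatewise_max d X"
            by (rule L(2)) (use X cv in auto)
          also have "\<dots> = poly_vec d (\<lambda>i. Max ((\<lambda>v. P v (v \<in> S) i) ` {1..m})) t"
            using elim(4) X by blast
          also have "\<dots> = poly_vec d Q t"
            by (auto simp: poly_vec_def Q_max[OF _ S] simp del: One_nat_def)
          finally have "agg L X = poly_vec d Q t" .
          then have "layer_step (star_graph g m n p S) L (emb t) (g 0) =
              com L (poly_vec (2 * d) (cat (P 0 False) Q) t)"
            unfolding layer_step_def neighbors_star_graph(1)[OF g] X_def[symmetric]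
            by (simp add: emb0 append_poly_vec cat_def[abs_def])
          then show ?thesis
            using True elim(3) by (simp add: P'_def)
        next
          case False
          then have v1: "v \<in> {1..m}" using v by auto
          have "agg L {#emb t (g 0)#} = coordinatewise_max d {#emb t (g 0)#}"
            by (rule L(2)) (use emb0 cv in auto)
          also have "\<dots> = poly_vec d (P 0 False) t"
            by (auto simp: emb0 coordinatewise_max_def poly_vec_def)
          finally have "layer_step (star_graph g m n p S) L (emb t) (g v) =
              com L (poly_vec (2 * d) (cat (P v (v \<in> S)) (P 0 False)) t)"
            unfolding layer_step_def neighbors_star_graph(2)[OF g v1]
            by (simp add: emb[OF v] append_poly_vec cat_def[abs_def])
          then show ?thesis
            using False elim(1) v by (simp add: P'_def)
        qed
      qed
    qed
  qed
  ultimately show ?thesis by blast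
qed

text \<open>Each layer gives up one leaf at either end of \<open>{a..b}\<close>. The sets in
  \<open>\<S>\<close> keep a margin of \<open>length N\<close> from both ends, so they stay strictly
  inside while a layer remains. They are treated together because they must share the final
  \<open>P'\<close>.\<close>

lemma star_fold_layer_step:
  assumes g: "inj g"
    and "\<And>S. S \<in> \<S> \<Longrightarrow> S \<noteq> {} \<and> S \<subseteq> {a + length N..c}"
    and "\<And>L. L \<in> set N \<Longrightarrow> \<exists>C. poly_lift (2 * in_dim L) (out_dim L) (com L) C"
    and "\<And>L X. L \<in> set N \<Longrightarrow> set_mset X \<subseteq> carrier_vec (in_dim L) \<Longrightarrow>
      agg L X = coordinatewise_max (in_dim L) X"
    and "\<And>i. Suc i < length N \<Longrightarrow> out_dim (N ! i) = in_dim (N ! Suc i)"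
    and "N \<noteq> [] \<Longrightarrow> in_dim (hd N) = d"
    and "1 \<le> a" "a + length N \<le> c" "c + length N \<le> b" "b \<le> m"
    and "star_state m d a b P"
    and "\<And>S. S \<in> \<S> \<Longrightarrow> star_represents g m S d (emb S) P"
  shows "\<exists>d' P'. \<forall>S\<in>\<S>. star_represents g m S d'
    (\<lambda>t. fold (layer_step (star_graph g m n p S)) N (emb S t)) P'"
  using assms(2-)
proof (induction N arbitrary: d a b P emb)
  case Nil
  then show ?case by auto
next
  case (Cons L N)
  have L: "in_dim L = d" using Cons.prems(5) by simp
  obtain C where C: "poly_lift (2 * d) (out_dim L) (com L) C"
    using Cons.prems(2)[of L] L by auto
  have "a < b" using Cons.prems(7,8) by simp
  obtain P' where P': "star_state m (out_dim L) (Suc a) (b - 1) P'"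
    "\<And>S emb. S \<noteq> {} \<Longrightarrow> S \<subseteq> {a<..<b} \<Longrightarrow> star_represents g m S d emb P \<Longrightarrow>
       star_represents g m S (out_dim L) (\<lambda>t. layer_step (star_graph g m n p S) L (emb t)) P'"
    using star_layer_step[OF g Cons.prems(6,9) \<open>a < b\<close> L _ C Cons.prems(10), of n p]
      Cons.prems(3)[of L] L by auto
  have sub: "S \<noteq> {}" "S \<subseteq> {a<..<b}" if "S \<in> \<S>" for S
    using Cons.prems(1)[OF that] Cons.prems(8) by auto
  have "\<exists>d' P'. \<forall>S\<in>\<S>. star_represents g m S d' (\<lambda>t. fold (layer_step (star_graph g m n p S)) N
      (layer_step (star_graph g m n p S) L (emb S t))) P'"
  proof (rule Cons.IH[where d = "out_dim L" and a = "Suc a" and b = "b - 1" and P = P'])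
    show "out_dim (N ! i) = in_dim (N ! Suc i)" if "Suc i < length N" for i
      using Cons.prems(4)[of "Suc i"] that by simp
    show "in_dim (hd N) = out_dim L" if "N \<noteq> []"
      using Cons.prems(4)[of 0] that by (simp add: hd_conv_nth)
    show "star_represents g m S (out_dim L) (\<lambda>t. layer_step (star_graph g m n p S) L (emb S t)) P'"
      if "S \<in> \<S>" for S
      using P'(2)[OF sub[OF that] Cons.prems(11)[OF that]] .
  qed (use Cons.prems P'(1) in auto)
  then show ?case by simp
qed

text \<open>Labels are constants and the key of leaf \<open>v\<close> is \<open>t ^ v\<close>, the
  uniform shape with \<open>A = 1\<close> and \<open>B = 0\<close>. The center has key
  \<open>t ^ 0 = 1\<close>, which avoids every interval with \<open>1 \<le> a\<close>.\<close>

lemma star_initial_emb: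
  fixes g :: "nat \<Rightarrow> 'v" and n p :: nat
  assumes g: "inj g" and a: "1 \<le> a"
  defines "P \<equiv> \<lambda>v l i. if i < n then [:if i = p \<and> l then 1 else 0:] else monom 1 v"
  shows "star_state m (n + 1) a b P"
    and "star_represents g m S (n + 1)
      (\<lambda>t. initial_emb (star_graph g m n p S) (\<lambda>u. t ^ the_inv g u)) P"
proof -
  have "uniform_on a b (\<lambda>v l. P v l i)" for i
  proof (cases "i < n")
    case True
    then show ?thesis by (simp add: P_def uniform_on_const)
  next
    case False
    then show ?thesis
      by (intro uniform_onI[where A = 1 and B = 0 and c = "\<lambda>_. 0"])
         (simp_all add: P_def avoids_def)
  qed
  moreover have "avoids a b (P v False i)" if "v \<notin> {a..b}" for v i
    using that a by (auto simp: P_def avoids_def coeff_pCons split: nat.split)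
  ultimately show "star_state m (n + 1) a b P"
    by (auto simp: star_state_def)
  show "star_represents g m S (n + 1)
      (\<lambda>t. initial_emb (star_graph g m n p S) (\<lambda>u. t ^ the_inv g u)) P"
    unfolding star_represents_def
  proof (intro always_eventually allI ballI)
    fix t v
    show "initial_emb (star_graph g m n p S) (\<lambda>u. t ^ the_inv g u) (g v) = poly_vec (n + 1) (P v (v \<in> S)) t"
      by (rule eq_vecI)
         (auto simp: initial_emb_def star_graph_def poly_vec_def P_def the_inv_f_f[OF g] poly_monom
           less_Suc_eq)
  qed
qed

section \<open>One labeled leaf against two\<close>

theorem theorem4p10:
  fixes n p :: nat
  assumes "p < n"
  shows "\<not> (\<exists>N. local_max_gnn n N \<and>
      (\<forall>L\<in>set N. feedforward {f. unary_semilinear f} (2 * in_dim L) (out_dim L) (com L)) \<and>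
      key_invariant TYPE('v::infinite) n N \<and>
      expresses n N (diamond_ge2_query n p :: 'v pointed_graph set))"
proof
  assume "\<exists>N. local_max_gnn n N \<and>
      (\<forall>L\<in>set N. feedforward {f. unary_semilinear f} (2 * in_dim L) (out_dim L) (com L)) \<and>
      key_invariant TYPE('v::infinite) n N \<and>
      expresses n N (diamond_ge2_query n p :: 'v pointed_graph set)"
  then obtain N where N: "local_max_gnn n N"
    and ff: "\<forall>L\<in>set N. feedforward {f. unary_semilinear f} (2 * in_dim L) (out_dim L) (com L)"
    and inv: "key_invariant TYPE('v) n N"
    and expr: "expresses n N (diamond_ge2_query n p :: 'v pointed_graph set)"
    by blast
  obtain g :: "nat \<Rightarrow> 'v" where g: "inj g"
    using infinite_countable_subset[OF infinite_UNIV] by blast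
  define k where "k = length N"
  \<comment> \<open>Every layer uses up one leaf on each side; the leaves \<open>k + 1\<close> and
    \<open>k + 2\<close> in the middle remain for the labels.\<close>
  define m where "m = 2 * k + 2"
  define S1 where "S1 = {k + 1}"
  define S2 where "S2 = {k + 1, k + 2}"
  define G where "G = star_graph g m n p"
  define key where "key t u = t ^ the_inv g u" for t :: real and u
  have card: "card {v \<in> neighbors (G S) (g 0). lab (G S) v $ p = 1} = card S" if "S \<subseteq> {1..m}" for S
  proof -
    have "{v \<in> neighbors (G S) (g 0). lab (G S) v $ p = 1} = g ` S"
      unfolding G_def neighbors_star_graph(1)[OF g]
      using that assms by (auto simp: star_graph_def the_inv_f_f[OF g])
    then show ?thesis using g by (simp add: card_image inj_on_subset[OF g])
  qed
  have pg: "(G S, g 0) \<in> pointed_graphs n" for S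
    using is_graph_star_graph[OF g] by (auto simp: pointed_graphs_def G_def star_graph_def)
  have is_key: "is_key (G S) (key t)" if "t > 1" for S t
    using that by (auto simp: is_key_def G_def star_graph_def key_def inj_on_def the_inv_f_f[OF g])
  have "S1 \<subseteq> {1..m}" "S2 \<subseteq> {1..m}" "card S1 = 1" "card S2 = 2"
    by (auto simp: S1_def S2_def m_def)
  then have mem: "(G S1, g 0) \<notin> diamond_ge2_query n p" "(G S2, g 0) \<in> diamond_ge2_query n p"
    using pg card by (auto simp: diamond_ge2_query_def)
  have acc2: "accepts N (G S2, g 0) (key t)" if "t > 1" for t
    using mem(2) expr is_key[OF that] unfolding expresses_def by auto
  \<comment> \<open>\<open>expresses\<close> yields only some key for which the graph of
    \<open>S1\<close> is rejected; key-invariance extends the rejection to all keys.\<close>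
  have acc1: "\<not> accepts N (G S1, g 0) (key t)" if "t > 1" for t
  proof
    assume acc: "accepts N (G S1, g 0) (key t)"
    have "(\<forall>key. is_key (G S1) key \<longrightarrow> accepts N (G S1, g 0) key) \<or>
        (\<forall>key. is_key (G S1) key \<longrightarrow> \<not> accepts N (G S1, g 0) key)"
      using inv pg unfolding key_invariant_def by fastforce
    then have "\<forall>key. is_key (G S1) key \<longrightarrow> accepts N (G S1, g 0) key"
      using acc is_key[OF that] by blast
    then have "(G S1, g 0) \<in> diamond_ge2_query n p"
      using expr pg unfolding expresses_def by auto
    then show False using mem(1) by blast
  qed
  have lift: "\<exists>C. poly_lift (2 * in_dim L) (out_dim L) (com L) C" if "L \<in> set N" for L
    using ff that feedforward_poly_lift by blast
  have "\<exists>d' P'. \<forall>S\<in>{S1, S2}. star_represents g m S d'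
      (\<lambda>t. fold (layer_step (star_graph g m n p S)) N
        (initial_emb (star_graph g m n p S) (\<lambda>u. t ^ the_inv g u))) P'"
  proof (rule star_fold_layer_step[where d = "n + 1" and a = 1 and b = m and c = "k + 2",
        OF g _ lift])
    show "agg L X = coordinatewise_max (in_dim L) X"
      if "L \<in> set N" "set_mset X \<subseteq> carrier_vec (in_dim L)" for L X
      using N that by (simp add: local_max_gnn_def)
    show "out_dim (N ! i) = in_dim (N ! Suc i)" if "Suc i < length N" for i
      using N that by (simp add: local_max_gnn_def is_gnn_def)
    show "in_dim (hd N) = n + 1"
      using N by (simp add: local_max_gnn_def is_gnn_def)
    show "star_state m (n + 1) 1 m
        (\<lambda>v l i. if i < n then [:if i = p \<and> l then 1 else 0:] else monom 1 v)"
      by (rule star_initial_emb(1)[OF g]) simp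
    show "star_represents g m S (n + 1)
        (\<lambda>t. initial_emb (star_graph g m n p S) (\<lambda>u. t ^ the_inv g u))
        (\<lambda>v l i. if i < n then [:if i = p \<and> l then 1 else 0:] else monom 1 v)" for S
      by (rule star_initial_emb(2)[OF g, of 1]) simp
  qed (auto simp: S1_def S2_def m_def k_def)
  then obtain d' P' where
    "star_represents g m S1 d' (\<lambda>t. fold (layer_step (G S1)) N (initial_emb (G S1) (key t))) P'"
    "star_represents g m S2 d' (\<lambda>t. fold (layer_step (G S2)) N (initial_emb (G S2) (key t))) P'"
    unfolding G_def key_def by blast
  \<comment> \<open>Both final embeddings are given by the same \<open>P'\<close>, and the center is
    unlabeled in both graphs.\<close>
  then have "eventually (\<lambda>t. fold (layer_step (G S1)) N (initial_emb (G S1) (key t)) (g 0) =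
      fold (layer_step (G S2)) N (initial_emb (G S2) (key t)) (g 0) \<and> t > 1) at_top"
    using eventually_gt_at_top[of 1] unfolding star_represents_def
    by eventually_elim (auto simp: S1_def S2_def)
  then obtain t where t: "fold (layer_step (G S1)) N (initial_emb (G S1) (key t)) (g 0) =
      fold (layer_step (G S2)) N (initial_emb (G S2) (key t)) (g 0)" "t > 1"
    using eventually_happens'[OF trivial_limit_at_top_linorder] by blast
  then have "accepts N (G S1, g 0) (key t) \<longleftrightarrow> accepts N (G S2, g 0) (key t)"
    by (simp add: accepts_def gnn_output_def)
  then show False
    using acc1 acc2 t(2) by blast
qed

end
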